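(* Let $(W,S)$ be a Coxeter system of type $\Lambda$ and let $\alpha$ and $\beta$ be braid equivalent reduced expressions. Then the distance between $\alpha$ and $\beta$ in the braid graph $\mathcal{B}(\alpha)$ is $d(\alpha,\beta)=\Delta(\operatorname{sig}(\alpha),\operatorname{sig}(\beta))$.
   Context: A Coxeter system $(W,S)$ consists of a finite set $S$ and the group $W=\langle S\mid (st)^{m(s,t)}=e\rangle$, where $m(s,s)=1$ and $m(s,t)=m(t,s)\in\{2,3,\dots\}\cup\{\infty\}$ for $s\neq t$ ($m(s,t)=\infty$ means no relation). Its Coxeter graph has vertex set $S$ and an edge $\{s,t\}$ whenever $m(s,t)\ge 3$. $(W,S)$ is of type $\Lambda$ if $m(s,t)\le 3$ for all $s,t\in S$ (simply laced) and the Coxeter graph contains no three-cycles (triangle free). A reduced expression for $w\in W$ is a word over $S$ of minimal length representing $w$. A braid move replaces three consecutive letters $sts$ by $tst$, where $m(s,t)=3$. Two reduced expressions are braid equivalent if they are related by a finite sequence of braid moves; $[\alpha]$ denotes the braid class (equivalence class) of $\alpha$. The braid graph $\mathcal{B}(\alpha)$ has vertex set $[\alpha]$, with two vertices adjacent if and only if they are related by a single braid move; $d$ denotes its path metric. A braid shadow for a reduced expression $\alpha$ is a set of positions $\{i-1,i,i+1\}$ such that the letters of $\alpha$ in these positions form $sts$ with $m(s,t)=3$. $\mathcal{S}(\alpha)$ is the set of braid shadows for $\alpha$, and $\mathcal{S}([\alpha])=\bigcup_{\beta\in[\alpha]}\mathcal{S}(\beta)$. The center of a braid shadow $\{i-1,i,i+1\}\in\mathcal{S}([\alpha])$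 is the position $i$. The braid shadows in $\mathcal{S}([\alpha])$ are numbered from left to right. The signature $\operatorname{sig}(\alpha)$ is the ordered list whose $i$th entry $\operatorname{sig}_i(\alpha)$ is the letter of $\alpha$ in the center of the $i$th braid shadow of $[\alpha]$. For braid equivalent $\alpha,\beta$, $\Delta(\operatorname{sig}(\alpha),\operatorname{sig}(\beta))$ is the number of entries $i$ with $\operatorname{sig}_i(\alpha)\ne\operatorname{sig}_i(\beta)$. *)

theory Defs
  imports "HOL-Algebra.Group" "HOL-Library.Extended_Nat" "Graph_Theory.Graph_Theory"
begin

section \<open>Groups given by generators and relators\<close>

text \<open>
  A pair \<open>(s, True)\<close> stands for the generator \<open>s\<close>, the pair \<open>(s, False)\<close> for its formal inverse.
  The group presented by generators \<open>S\<close> and relators \<open>R\<close> consists of the words in these symbols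
  modulo the least congruence that cancels adjacent inverse symbols and makes every relator trivial.
\<close>

type_synonym 'a gword = "('a \<times> bool) list"

inductive_set pres_rel :: "'a set \<Rightarrow> 'a gword set \<Rightarrow> ('a gword \<times> 'a gword) set"
  for S :: "'a set" and R :: "'a gword set" where
  refl: "u \<in> lists (S \<times> UNIV) \<Longrightarrow> (u, u) \<in> pres_rel S R"
| sym: "(u, v) \<in> pres_rel S R \<Longrightarrow> (v, u) \<in> pres_rel S R"
| trans: "(u, v) \<in> pres_rel S R \<Longrightarrow> (v, w) \<in> pres_rel S R \<Longrightarrow> (u, w) \<in> pres_rel S R"
| append: "(u, v) \<in> pres_rel S R \<Longrightarrow> (x, y) \<in> pres_rel S R \<Longrightarrow> (u @ x, v @ y) \<in> pres_rel S R"
| cancel: "s \<in> S \<Longrightarrow> ([(s, b), (s, \<not> b)], []) \<in> pres_rel S R"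
| relator: "r \<in> R \<Longrightarrow> r \<in> lists (S \<times> UNIV) \<Longrightarrow> (r, []) \<in> pres_rel S R"

definition presented_group :: "'a set \<Rightarrow> 'a gword set \<Rightarrow> 'a gword set monoid" where
  "presented_group S R =
     \<lparr>carrier = lists (S \<times> UNIV) // pres_rel S R,
      monoid.mult = (\<lambda>A B. \<Union>a\<in>A. \<Union>b\<in>B. pres_rel S R `` {a @ b}),
      monoid.one = pres_rel S R `` {[]}\<rparr>"

definition presented_gen :: "'a set \<Rightarrow> 'a gword set \<Rightarrow> 'a \<Rightarrow> 'a gword set" where
  "presented_gen S R s = pres_rel S R `` {[(s, True)]}"

lemma pres_rel_in_lists:
  "(u, v) \<in> pres_rel S R \<Longrightarrow> u \<in> lists (S \<times> UNIV) \<and> v \<in> lists (S \<times> UNIV)"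
  by (induction rule: pres_rel.induct) auto

lemma equiv_pres_rel: "equiv (lists (S \<times> UNIV)) (pres_rel S R)"
proof (rule equivI)
  show "pres_rel S R \<subseteq> lists (S \<times> UNIV) \<times> lists (S \<times> UNIV)"
    using pres_rel_in_lists by fast
  show "refl_on (lists (S \<times> UNIV)) (pres_rel S R)"
    by (rule refl_onI) (rule pres_rel.refl)
  show "sym (pres_rel S R)" by (rule symI) (rule pres_rel.sym)
  show "trans (pres_rel S R)" by (rule transI) (rule pres_rel.trans)
qed

lemma presented_group_mult:
  assumes "u \<in> lists (S \<times> UNIV)" "v \<in> lists (S \<times> UNIV)"
  shows "pres_rel S R `` {u} \<otimes>\<^bsub>presented_group S R\<^esub> pres_rel S R `` {v} = pres_rel S R `` {u @ v}"
proof -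
  let ?U = "pres_rel S R `` {u}" and ?V = "pres_rel S R `` {v}"
  have "pres_rel S R `` {a @ b} = pres_rel S R `` {u @ v}" if "a \<in> ?U" "b \<in> ?V" for a b
    using that by (intro equiv_class_eq[OF equiv_pres_rel] pres_rel.append) (auto intro: pres_rel.sym)
  then have "(\<Union>a\<in>?U. \<Union>b\<in>?V. pres_rel S R `` {a @ b})
      = (\<Union>a\<in>?U. \<Union>b\<in>?V. pres_rel S R `` {u @ v})"
    by (meson SUP_cong)
  moreover have "u \<in> ?U" "v \<in> ?V" using assms by (auto intro: pres_rel.refl)
  ultimately show ?thesis unfolding presented_group_def monoid.simps by blast
qed

lemma presented_group_carrierE:
  assumes "x \<in> carrier (presented_group S R)"
  obtains u where "u \<in> lists (S \<times> UNIV)" "x = pres_rel S R `` {u}"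
  using assms by (auto simp: presented_group_def elim!: quotientE)

lemma presented_group_carrierI:
  "u \<in> lists (S \<times> UNIV) \<Longrightarrow> pres_rel S R `` {u} \<in> carrier (presented_group S R)"
  by (auto simp: presented_group_def intro: quotientI)

lemma pres_rel_inverse:
  "u \<in> lists (S \<times> UNIV) \<Longrightarrow> (rev (map (\<lambda>(s, b). (s, \<not> b)) u) @ u, []) \<in> pres_rel S R"
proof (induction u)
  case Nil
  then show ?case by (simp add: pres_rel.refl)
next
  case (Cons a u)
  obtain s b where a: "a = (s, b)" by force
  let ?i = "rev (map (\<lambda>(s, b). (s, \<not> b)) u)"
  from Cons.prems a have s: "s \<in> S" and u: "u \<in> lists (S \<times> UNIV)" by auto
  have i: "?i \<in> lists (S \<times> UNIV)" using u by (auto simp: in_lists_conv_set)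
  have "([(s, \<not> b), (s, \<not> \<not> b)] @ u, [] @ u) \<in> pres_rel S R"
    by (intro pres_rel.append pres_rel.cancel s pres_rel.refl u)
  then have "(?i @ [(s, \<not> b), (s, b)] @ u, ?i @ u) \<in> pres_rel S R"
    using pres_rel.append[OF pres_rel.refl[OF i]] by fastforce
  then show ?case using Cons.IH[OF u] a by (auto intro: pres_rel.trans)
qed

lemma group_presented_group: "group (presented_group S R)"
proof (rule groupI)
  let ?G = "presented_group S R"
  have one: "\<one>\<^bsub>?G\<^esub> = pres_rel S R `` {[]}" by (simp add: presented_group_def)
  show "\<one>\<^bsub>?G\<^esub> \<in> carrier ?G" unfolding one by (rule presented_group_carrierI) simp
  fix x assume x: "x \<in> carrier ?G"
  then obtain u where u: "u \<in> lists (S \<times> UNIV)" "x = pres_rel S R `` {u}"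
    by (rule presented_group_carrierE)
  show "\<one>\<^bsub>?G\<^esub> \<otimes>\<^bsub>?G\<^esub> x = x"
    using presented_group_mult[of "[]" S u R] u one by simp
  show "\<exists>y\<in>carrier ?G. y \<otimes>\<^bsub>?G\<^esub> x = \<one>\<^bsub>?G\<^esub>"
  proof
    let ?i = "rev (map (\<lambda>(s, b). (s, \<not> b)) u)"
    have i: "?i \<in> lists (S \<times> UNIV)" using u by (auto simp: in_lists_conv_set)
    show "pres_rel S R `` {?i} \<in> carrier ?G" by (rule presented_group_carrierI[OF i])
    show "pres_rel S R `` {?i} \<otimes>\<^bsub>?G\<^esub> x = \<one>\<^bsub>?G\<^esub>"
      unfolding u(2) one presented_group_mult[OF i u(1)]
      by (rule equiv_class_eq[OF equiv_pres_rel pres_rel_inverse[OF u(1)]])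
  qed
  fix y assume "y \<in> carrier ?G"
  then obtain v where v: "v \<in> lists (S \<times> UNIV)" "y = pres_rel S R `` {v}"
    by (rule presented_group_carrierE)
  show "x \<otimes>\<^bsub>?G\<^esub> y \<in> carrier ?G"
    unfolding u(2) v(2) presented_group_mult[OF u(1) v(1)]
    by (rule presented_group_carrierI) (use u v in auto)
  fix z assume "z \<in> carrier ?G"
  then obtain w where w: "w \<in> lists (S \<times> UNIV)" "z = pres_rel S R `` {w}"
    by (rule presented_group_carrierE)
  have uv: "u @ v \<in> lists (S \<times> UNIV)" and vw: "v @ w \<in> lists (S \<times> UNIV)"
    using u(1) v(1) w(1) by auto
  show "x \<otimes>\<^bsub>?G\<^esub> y \<otimes>\<^bsub>?G\<^esub> z = x \<otimes>\<^bsub>?G\<^esub> (y \<otimes>\<^bsub>?G\<^esub> z)"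
    unfolding u(2) v(2) w(2) presented_group_mult[OF u(1) v(1)] presented_group_mult[OF v(1) w(1)]
      presented_group_mult[OF uv w(1)] presented_group_mult[OF u(1) vw] append_assoc
    by (rule HOL.refl)
qed

text \<open>The universal property of the presentation.\<close>

lemma presented_group_universal:
  fixes H (structure) and f :: "'a \<Rightarrow> 'h"
  defines "ev \<equiv> \<lambda>w. foldr (\<lambda>(s, b) x. (if b then f s else inv f s) \<otimes> x) w \<one>"
  assumes "group H" and f: "f \<in> S \<rightarrow> carrier H"
    and rel: "\<And>r. r \<in> R \<Longrightarrow> r \<in> lists (S \<times> UNIV) \<Longrightarrow> ev r = \<one>"
  shows "\<exists>h\<in>hom (presented_group S R) H. \<forall>s\<in>S. h (presented_gen S R s) = f s"
proof -
  interpret H: group H by fact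
  have ev_simps: "ev [] = \<one>" "ev ((s, b) # w) = (if b then f s else inv f s) \<otimes> ev w" for s b w
    by (simp_all add: ev_def)
  have ev_closed: "ev w \<in> carrier H" if "w \<in> lists (S \<times> UNIV)" for w
    using that
  proof (induction w)
    case (Cons a w)
    then show ?case using f by (cases a) (auto simp: ev_simps Pi_def)
  qed (simp add: ev_simps)
  have ev_append: "ev (u @ v) = ev u \<otimes> ev v"
    if "u \<in> lists (S \<times> UNIV)" "v \<in> lists (S \<times> UNIV)" for u v
    using that
  proof (induction u)
    case (Cons a w)
    then show ?case using f ev_closed[of w] ev_closed[of v]
      by (cases a) (auto simp: ev_simps Pi_def H.m_assoc)
  qed (simp add: ev_simps ev_closed)
  have ev_eq: "(u, v) \<in> pres_rel S R \<Longrightarrow> ev u = ev v" for u v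
  proof (induction rule: pres_rel.induct)
    case (append u v x y)
    then show ?case using pres_rel_in_lists ev_append by metis
  next
    case (cancel s b)
    then show ?case using f by (auto simp: ev_simps Pi_def)
  next
    case (relator r)
    then show ?case using rel by (simp add: ev_simps)
  qed simp_all
  define h where "h A = ev (SOME u. u \<in> A)" for A
  have h: "h (pres_rel S R `` {u}) = ev u" if "u \<in> lists (S \<times> UNIV)" for u
  proof -
    have "(SOME v. v \<in> pres_rel S R `` {u}) \<in> pres_rel S R `` {u}"
      by (rule someI[of _ u]) (simp add: pres_rel.refl that)
    then show ?thesis unfolding h_def using ev_eq by (metis Image_singleton_iff)
  qed
  have "h \<in> hom (presented_group S R) H"
  proof (rule homI)
    fix x assume "x \<in> carrier (presented_group S R)"
    then obtain u where u: "u \<in> lists (S \<times> UNIV)" "x = pres_rel S R `` {u}"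
      by (rule presented_group_carrierE)
    then show "h x \<in> carrier H" by (simp add: h ev_closed)
    fix y assume "y \<in> carrier (presented_group S R)"
    then obtain v where v: "v \<in> lists (S \<times> UNIV)" "y = pres_rel S R `` {v}"
      by (rule presented_group_carrierE)
    show "h (x \<otimes>\<^bsub>presented_group S R\<^esub> y) = h x \<otimes> h y"
      using u v h[of "u @ v"] by (simp add: presented_group_mult h ev_append)
  qed
  moreover have "h (presented_gen S R s) = f s" if "s \<in> S" for s
    using that f h[of "[(s, True)]"] by (auto simp: presented_gen_def ev_simps Pi_def)
  ultimately show ?thesis by blast
qed


section \<open>Coxeter systems\<close>

text \<open>
  The parameter \<open>m\<close> is the Coxeter matrix, only its values on \<open>S\<close> matter. A pair \<open>(S, m)\<close>
  with \<open>coxeter_system S m\<close> determines the group \<open>coxeter_group S m\<close>.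
\<close>

definition coxeter_system :: "'a set \<Rightarrow> ('a \<Rightarrow> 'a \<Rightarrow> enat) \<Rightarrow> bool" where
  "coxeter_system S m \<longleftrightarrow>
     finite S \<and>
     (\<forall>s\<in>S. m s s = 1) \<and>
     (\<forall>s\<in>S. \<forall>t\<in>S. m s t = m t s) \<and>
     (\<forall>s\<in>S. \<forall>t\<in>S. s \<noteq> t \<longrightarrow> 2 \<le> m s t)"

definition coxeter_relators :: "'a set \<Rightarrow> ('a \<Rightarrow> 'a \<Rightarrow> enat) \<Rightarrow> 'a gword set" where
  "coxeter_relators S m =
     {concat (replicate k [(s, True), (t, True)]) | s t k. s \<in> S \<and> t \<in> S \<and> m s t = enat k}"

definition coxeter_group :: "'a set \<Rightarrow> ('a \<Rightarrow> 'a \<Rightarrow> enat) \<Rightarrow> 'a gword set monoid" where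
  "coxeter_group S m = presented_group S (coxeter_relators S m)"

definition coxeter_gen :: "'a set \<Rightarrow> ('a \<Rightarrow> 'a \<Rightarrow> enat) \<Rightarrow> 'a \<Rightarrow> 'a gword set" where
  "coxeter_gen S m s = presented_gen S (coxeter_relators S m) s"

definition coxeter_edges :: "'a set \<Rightarrow> ('a \<Rightarrow> 'a \<Rightarrow> enat) \<Rightarrow> 'a set set" where
  "coxeter_edges S m = {{s, t} | s t. s \<in> S \<and> t \<in> S \<and> 3 \<le> m s t}"

definition type_Lambda :: "'a set \<Rightarrow> ('a \<Rightarrow> 'a \<Rightarrow> enat) \<Rightarrow> bool" where
  "type_Lambda S m \<longleftrightarrow>
     (\<forall>s\<in>S. \<forall>t\<in>S. m s t \<le> 3) \<and>
     \<not> (\<exists>s\<in>S. \<exists>t\<in>S. \<exists>u\<in>S. s \<noteq> t \<and> t \<noteq> u \<and> u \<noteq> s \<and>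
          {s, t} \<in> coxeter_edges S m \<and> {t, u} \<in> coxeter_edges S m \<and> {u, s} \<in> coxeter_edges S m)"


section \<open>Reduced expressions, braid classes and braid graphs\<close>

definition word_value :: "'a set \<Rightarrow> ('a \<Rightarrow> 'a \<Rightarrow> enat) \<Rightarrow> 'a list \<Rightarrow> 'a gword set" where
  "word_value S m \<alpha> =
     foldr (\<lambda>s g. coxeter_gen S m s \<otimes>\<^bsub>coxeter_group S m\<^esub> g) \<alpha> \<one>\<^bsub>coxeter_group S m\<^esub>"

definition reduced_expression_for ::
    "'a set \<Rightarrow> ('a \<Rightarrow> 'a \<Rightarrow> enat) \<Rightarrow> 'a gword set \<Rightarrow> 'a list \<Rightarrow> bool" where
  "reduced_expression_for S m w \<alpha> \<longleftrightarrow>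
     is_arg_min length (\<lambda>\<gamma>. \<gamma> \<in> lists S \<and> word_value S m \<gamma> = w) \<alpha>"

definition reduced_expression :: "'a set \<Rightarrow> ('a \<Rightarrow> 'a \<Rightarrow> enat) \<Rightarrow> 'a list \<Rightarrow> bool" where
  "reduced_expression S m \<alpha> \<longleftrightarrow>
     (\<exists>w \<in> carrier (coxeter_group S m). reduced_expression_for S m w \<alpha>)"

definition braid_move :: "'a set \<Rightarrow> ('a \<Rightarrow> 'a \<Rightarrow> enat) \<Rightarrow> 'a list \<Rightarrow> 'a list \<Rightarrow> bool" where
  "braid_move S m \<alpha> \<beta> \<longleftrightarrow>
     (\<exists>u v s t. s \<in> S \<and> t \<in> S \<and> m s t = 3 \<and> \<alpha> = u @ [s, t, s] @ v \<and> \<beta> = u @ [t, s, t] @ v)"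

text \<open>
  Braid moves are symmetric and turn reduced expressions into reduced expressions (see
  \<open>reduced_expression_braid_equiv\<close> below), so the sequences of braid moves starting at a reduced
  expression stay among reduced expressions and form an equivalence relation there.
\<close>

definition braid_equiv :: "'a set \<Rightarrow> ('a \<Rightarrow> 'a \<Rightarrow> enat) \<Rightarrow> 'a list \<Rightarrow> 'a list \<Rightarrow> bool" where
  "braid_equiv S m = (braid_move S m)\<^sup>*\<^sup>*"

definition braid_class :: "'a set \<Rightarrow> ('a \<Rightarrow> 'a \<Rightarrow> enat) \<Rightarrow> 'a list \<Rightarrow> 'a list set" where
  "braid_class S m \<alpha> = {\<beta>. braid_equiv S m \<alpha> \<beta>}"

text \<open>The undirected braid graph is encoded as a symmetric digraph.\<close>

definition braid_graph :: "'a set \<Rightarrow> ('a \<Rightarrow> 'a \<Rightarrow> enat) \<Rightarrow> 'a list \<Rightarrow> 'a list pair_pre_digraph" where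
  "braid_graph S m \<alpha> =
     \<lparr>pverts = braid_class S m \<alpha>,
      parcs = {(\<beta>, \<gamma>). \<beta> \<in> braid_class S m \<alpha> \<and> \<gamma> \<in> braid_class S m \<alpha> \<and> braid_move S m \<beta> \<gamma>}\<rparr>"

text \<open>
  With every arc of weight 1, \<open>wf_digraph.\<mu>\<close> is the infimum of the numbers of arcs of the walks
  from \<open>u\<close> to \<open>v\<close>, and it is \<open>\<infinity>\<close> if there is no such walk.
\<close>

definition graph_dist :: "'v pair_pre_digraph \<Rightarrow> 'v \<Rightarrow> 'v \<Rightarrow> ereal" where
  "graph_dist G u v = wf_digraph.\<mu> (with_proj G) (\<lambda>_. 1) u v"


section \<open>Braid shadows and signatures\<close>

text \<open>Positions in words are counted from 0.\<close>

definition braid_shadows :: "'a set \<Rightarrow> ('a \<Rightarrow> 'a \<Rightarrow> enat) \<Rightarrow> 'a list \<Rightarrow> nat set set" where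
  "braid_shadows S m \<alpha> =
     {{i - 1, i, i + 1} | i. 1 \<le> i \<and> i + 1 < length \<alpha> \<and>
        (\<exists>s\<in>S. \<exists>t\<in>S. m s t = 3 \<and> \<alpha> ! (i - 1) = s \<and> \<alpha> ! i = t \<and> \<alpha> ! (i + 1) = s)}"

definition class_shadows :: "'a set \<Rightarrow> ('a \<Rightarrow> 'a \<Rightarrow> enat) \<Rightarrow> 'a list \<Rightarrow> nat set set" where
  "class_shadows S m \<alpha> = (\<Union>\<beta>\<in>braid_class S m \<alpha>. braid_shadows S m \<beta>)"

definition shadow_centers :: "'a set \<Rightarrow> ('a \<Rightarrow> 'a \<Rightarrow> enat) \<Rightarrow> 'a list \<Rightarrow> nat set" where
  "shadow_centers S m \<alpha> = {i. 1 \<le> i \<and> {i - 1, i, i + 1} \<in> class_shadows S m \<alpha>}"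

text \<open>
  A shadow is determined by its center, and numbering the shadows from left to right amounts to
  listing their centers in increasing order. The set of centers is finite, see
  \<open>finite_shadow_centers\<close>.
\<close>

definition signature :: "'a set \<Rightarrow> ('a \<Rightarrow> 'a \<Rightarrow> enat) \<Rightarrow> 'a list \<Rightarrow> 'a list" where
  "signature S m \<alpha> = map (\<lambda>i. \<alpha> ! i) (sorted_list_of_set (shadow_centers S m \<alpha>))"

text \<open>Only used for lists of equal length.\<close>

definition Delta :: "'b list \<Rightarrow> 'b list \<Rightarrow> nat" where
  "Delta \<sigma> \<tau> = card {i. i < length \<sigma> \<and> \<sigma> ! i \<noteq> \<tau> ! i}"


section \<open>Sanity checks\<close>

lemma word_value_eq_class:
  assumes "\<alpha> \<in> lists S"
  shows "word_value S m \<alpha> = pres_rel S (coxeter_relators S m) `` {map (\<lambda>s. (s, True)) \<alpha>}"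
  using assms
proof (induction \<alpha>)
  case Nil
  then show ?case by (simp add: word_value_def coxeter_group_def presented_group_def)
next
  case (Cons s \<alpha>)
  have "word_value S m (s # \<alpha>) = coxeter_gen S m s \<otimes>\<^bsub>coxeter_group S m\<^esub> word_value S m \<alpha>"
    by (simp add: word_value_def)
  also have "\<dots> = pres_rel S (coxeter_relators S m) `` {[(s, True)] @ map (\<lambda>s. (s, True)) \<alpha>}"
    unfolding coxeter_gen_def presented_gen_def coxeter_group_def Cons.IH
    by (rule presented_group_mult) (use Cons.hyps in \<open>auto simp: in_lists_conv_set\<close>)
  finally show ?case by simp
qed

lemma word_value_append:
  assumes "\<alpha> \<in> lists S" "\<beta> \<in> lists S"
  shows "word_value S m (\<alpha> @ \<beta>) = word_value S m \<alpha> \<otimes>\<^bsub>coxeter_group S m\<^esub> word_value S m \<beta>"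
  using assms unfolding coxeter_group_def
  by (simp add: word_value_eq_class)
     (subst presented_group_mult, auto simp: in_lists_conv_set)

lemma braid_move_sym:
  "coxeter_system S m \<Longrightarrow> braid_move S m \<alpha> \<beta> \<Longrightarrow> braid_move S m \<beta> \<alpha>"
  unfolding coxeter_system_def braid_move_def by metis

lemma word_value_relator:
  assumes "s \<in> S" "t \<in> S" "m s t = enat k"
  shows "word_value S m (concat (replicate k [s, t])) = \<one>\<^bsub>coxeter_group S m\<^esub>"
proof -
  have eq: "map (\<lambda>s. (s, True)) (concat (replicate k [s, t]))
      = concat (replicate k [(s, True), (t, True)])"
    by (simp add: map_concat)
  have L: "concat (replicate k [s, t]) \<in> lists S" using assms by (auto simp: in_lists_conv_set)
  have "(concat (replicate k [(s, True), (t, True)]), []) \<in> pres_rel S (coxeter_relators S m)"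
    by (rule pres_rel.relator)
       (use assms in \<open>auto simp: coxeter_relators_def in_lists_conv_set\<close>)
  then show ?thesis
    unfolding word_value_eq_class[OF L] eq
    using equiv_class_eq[OF equiv_pres_rel]
    by (fastforce simp: coxeter_group_def presented_group_def)
qed

lemma word_value_braid_move:
  assumes C: "coxeter_system S m" and \<alpha>: "\<alpha> \<in> lists S" and mv: "braid_move S m \<alpha> \<beta>"
  shows "word_value S m \<beta> = word_value S m \<alpha>"
proof -
  from mv obtain u v s t where st: "s \<in> S" "t \<in> S" "m s t = 3"
    and \<alpha>_eq: "\<alpha> = u @ [s, t, s] @ v" and \<beta>_eq: "\<beta> = u @ [t, s, t] @ v"
    unfolding braid_move_def by blast
  have uv: "u \<in> lists S" "v \<in> lists S" using \<alpha> \<alpha>_eq by auto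
  let ?W = "word_value S m" and ?G = "coxeter_group S m"
  interpret G: group ?G unfolding coxeter_group_def by (rule group_presented_group)
  have clo: "?W x \<in> carrier ?G" if "x \<in> lists S" for x
    unfolding word_value_eq_class[OF that] coxeter_group_def
    by (rule presented_group_carrierI) (use that in auto)
  have sq: "?W [a, a] = \<one>\<^bsub>?G\<^esub>" if "a \<in> S" for a
    using word_value_relator[of a S a m 1] that C
    by (simp add: coxeter_system_def one_enat_def)
  have "?W [s, t, s, t, s, t] = \<one>\<^bsub>?G\<^esub>"
    using word_value_relator[of s S t m 3] st by (simp add: numeral_eq_enat numeral_3_eq_3)
  then have "?W [s, t, s] \<otimes>\<^bsub>?G\<^esub> ?W [t, s, t] = \<one>\<^bsub>?G\<^esub>"
    using word_value_append[of "[s, t, s]" S "[t, s, t]" m] st by simp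
  moreover have "?W [t, s, t] \<otimes>\<^bsub>?G\<^esub> ?W [t, s, t] = \<one>\<^bsub>?G\<^esub>"
  proof -
    have drop: "?W (x @ [a, a] @ y) = ?W (x @ y)"
      if "a \<in> S" "x \<in> lists S" "y \<in> lists S" for a x y
      using that clo by (subst word_value_append; simp)
        (subst word_value_append[of "[a, a]" S y m, simplified]; simp add: sq word_value_append)
    have "?W [t, s, t, t, s, t] = \<one>\<^bsub>?G\<^esub>"
      using drop[of t "[t, s]" "[s, t]"] drop[of s "[t]" "[t]"] sq[of t] st by simp
    then show ?thesis
      using word_value_append[of "[t, s, t]" S "[t, s, t]" m] st by simp
  qed
  ultimately have "?W [t, s, t] = ?W [s, t, s]"
    using clo st by (metis G.right_cancel lists.Cons lists.Nil)
  then show ?thesis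
    unfolding \<alpha>_eq \<beta>_eq using uv st by (simp add: word_value_append del: append.simps)
qed

lemma braid_move_lists: "\<alpha> \<in> lists S \<Longrightarrow> braid_move S m \<alpha> \<beta> \<Longrightarrow> \<beta> \<in> lists S"
  unfolding braid_move_def by auto

lemma braid_move_length: "braid_move S m \<alpha> \<beta> \<Longrightarrow> length \<beta> = length \<alpha>"
  unfolding braid_move_def by auto

lemma reduced_expression_braid_equiv:
  assumes "coxeter_system S m" "reduced_expression S m \<alpha>" "braid_equiv S m \<alpha> \<beta>"
  shows "reduced_expression S m \<beta>"
proof -
  from assms(3) have "(braid_move S m)\<^sup>*\<^sup>* \<alpha> \<beta>" by (simp add: braid_equiv_def)
  then show ?thesis
  proof (induction rule: rtranclp_induct)
    case (step \<beta> \<gamma>)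
    then show ?case
      using word_value_braid_move[OF assms(1)] braid_move_lists braid_move_length
      unfolding reduced_expression_def reduced_expression_for_def is_arg_min_def
      by metis
  qed (rule assms(2))
qed

lemma pair_wf_digraph_braid_graph: "pair_wf_digraph (braid_graph S m \<alpha>)"
  by unfold_locales (auto simp: braid_graph_def)

lemma sym_braid_graph: "coxeter_system S m \<Longrightarrow> sym (parcs (braid_graph S m \<alpha>))"
  by (auto simp: braid_graph_def sym_def intro: braid_move_sym)

lemma graph_dist_conv:
  assumes "pair_wf_digraph G"
  shows "graph_dist G u v = (INF p\<in>{p. pre_digraph.awalk (with_proj G) u p v}. ereal (real (length p)))"
proof -
  interpret pair_wf_digraph G by fact
  have "awalk_cost (\<lambda>_. 1) p = real (length p)" for p :: "('a \<times> 'a) list"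
    by (simp add: awalk_cost_def sum_list_triv)
  then show ?thesis by (simp add: graph_dist_def \<mu>_def)
qed

lemma finite_shadow_centers: "finite (shadow_centers S m \<alpha>)"
proof -
  have len: "length \<beta> = length \<alpha>" if "\<beta> \<in> braid_class S m \<alpha>" for \<beta>
  proof -
    have "(braid_move S m)\<^sup>*\<^sup>* \<alpha> \<beta>" using that by (simp add: braid_class_def braid_equiv_def)
    then show ?thesis by (induction rule: rtranclp_induct) (auto dest: braid_move_length)
  qed
  have "shadow_centers S m \<alpha> \<subseteq> {..<length \<alpha>}"
  proof
    fix i assume "i \<in> shadow_centers S m \<alpha>"
    then obtain \<beta> j where "\<beta> \<in> braid_class S m \<alpha>" "j + 1 < length \<beta>"
      "{i - 1, i, i + 1} = {j - 1, j, j + 1}"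
      unfolding shadow_centers_def class_shadows_def braid_shadows_def by blast
    moreover from this(3) have "i \<in> {j - 1, j, j + 1}" by blast
    ultimately show "i \<in> {..<length \<alpha>}" using len by auto
  qed
  then show ?thesis by (rule finite_subset) simp
qed

end

theory Submission
  imports Defs
begin

text \<open>
  Name a shadow by its first position \<open>p\<close>, so that its center is \<open>p + 1\<close>, and record a sequence of
  braid moves by the list of the shadows that it uses. Two facts carry the proof.

  First, centers of shadows occurring anywhere in one braid class are never adjacent
  (\<open>shadows_not_adjacent\<close>). In a counterexample with the shortest connecting sequence of moves, the
  minimality keeps every move away from the two middle positions, so each move takes place entirely
  to the left or entirely to the right of a cut between them. Performing the moves on one side
  only produces a member of the class that contains \<open>stst\<close>; one more braid move gives two equal
  neighbours, so that word is not reduced. Consequently the letter at a center is changed only by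
  moves at this very center.

  Second, a shortest sequence of moves uses no shadow twice (\<open>shortest_braid_path_distinct\<close>).
  Consider two uses of \<open>p\<close> with pairwise distinct moves, all different from \<open>p\<close>, in between. If none
  of them overlaps \<open>p\<close>, they commute with the move at \<open>p\<close>, and the two uses cancel. Otherwise one of
  them replaces an outer letter \<open>a\<close> of the pattern \<open>aba\<close> at \<open>p\<close> by a letter \<open>x\<close> bonded to \<open>a\<close>; for
  the second use the pattern must be \<open>xbx\<close>, so that \<open>a\<close>, \<open>b\<close>, \<open>x\<close> form a three-cycle in the
  Coxeter graph.

  Hence along a geodesic each center that is used has its letter changed exactly once, and every
  other center keeps its letter. The length of the geodesic is the number of centers at which the
  two ends differ.
\<close>

section \<open>Braid moves recorded by position\<close>

definition flip :: "nat \<Rightarrow> 'a list \<Rightarrow> 'a list" where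
  "flip p w = w[p := w ! (p + 1), p + 1 := w ! p, p + 2 := w ! (p + 1)]"

lemma length_flip [simp]: "length (flip p w) = length w"
  by (simp add: flip_def)

lemma length_fold_flip [simp]: "length (fold flip ps w) = length w"
  by (induction ps arbitrary: w) simp_all

lemma nth_flip:
  assumes "p + 2 < length w"
  shows "flip p w ! j =
    (if j = p \<or> j = p + 2 then w ! (p + 1) else if j = p + 1 then w ! p else w ! j)"
  using assms by (auto simp: flip_def nth_list_update nth_list_update_neq)

text \<open>
  The relation \<open>bond s t\<close> abstracts \<open>m s t = 3\<close>. A shadow or a move is identified by its first
  position, which makes the result of a sequence of moves a function of the list of positions.
\<close>

locale bond_relation =
  fixes bond :: "'a \<Rightarrow> 'a \<Rightarrow> bool"
  assumes bond_sym: "bond s t \<Longrightarrow> bond t s" and bond_irrefl: "\<not> bond s s"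
begin

definition shadow_at :: "nat \<Rightarrow> 'a list \<Rightarrow> bool" where
  "shadow_at p w \<longleftrightarrow> p + 2 < length w \<and> w ! (p + 2) = w ! p \<and> bond (w ! p) (w ! (p + 1))"

fun braid_path :: "'a list \<Rightarrow> nat list \<Rightarrow> bool" where
  "braid_path w [] \<longleftrightarrow> True"
| "braid_path w (p # ps) \<longleftrightarrow> shadow_at p w \<and> braid_path (flip p w) ps"

lemma braid_path_append:
  "braid_path w (ps @ qs) \<longleftrightarrow> braid_path w ps \<and> braid_path (fold flip ps w) qs"
  by (induction ps arbitrary: w) auto

lemma shadow_at_flip: "shadow_at p w \<Longrightarrow> shadow_at p (flip p w)"
  by (auto simp: shadow_at_def nth_flip bond_sym)

lemma flip_flip: "shadow_at p w \<Longrightarrow> flip p (flip p w) = w"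
  by (intro nth_equalityI) (auto simp: shadow_at_def nth_flip)

lemma braid_path_rev:
  "braid_path w ps \<Longrightarrow>
    braid_path (fold flip ps w) (rev ps) \<and> fold flip (rev ps) (fold flip ps w) = w"
  by (induction ps arbitrary: w) (auto simp: braid_path_append shadow_at_flip flip_flip)

lemma braid_path_connect:
  assumes "braid_path w ps" "braid_path w qs"
  shows "\<exists>rs. braid_path (fold flip ps w) rs \<and> fold flip rs (fold flip ps w) = fold flip qs w"
  using braid_path_rev[OF assms(1)] assms(2)
  by (intro exI[of _ "rev ps @ qs"]) (simp add: braid_path_append)

lemma fold_flip_untouched:
  assumes "braid_path w ps" and "\<And>r. r \<in> set ps \<Longrightarrow> j \<notin> {r, r + 1, r + 2}"
  shows "fold flip ps w ! j = w ! j"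
  using assms by (induction ps arbitrary: w) (auto simp: nth_flip shadow_at_def)

text \<open>
  If no move crosses the boundary of a set \<open>A\<close> of positions, then the moves inside \<open>A\<close> can be
  performed without the others, even on a word with different letters outside \<open>A\<close>.
\<close>

lemma braid_path_restrict:
  assumes "braid_path w ps" and "length v = length w" and "\<And>j. j \<in> A \<Longrightarrow> v ! j = w ! j"
    and "\<And>r. r \<in> set ps \<Longrightarrow> {r, r + 1, r + 2} \<subseteq> A \<or> {r, r + 1, r + 2} \<inter> A = {}"
  shows "braid_path v (filter (\<lambda>r. r \<in> A) ps)
    \<and> (\<forall>j\<in>A. fold flip (filter (\<lambda>r. r \<in> A) ps) v ! j = fold flip ps w ! j)
    \<and> (\<forall>j. j \<notin> A \<longrightarrow> fold flip (filter (\<lambda>r. r \<in> A) ps) v ! j = v ! j)"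
  using assms
proof (induction ps arbitrary: w v)
  case Nil
  then show ?case by simp
next
  case (Cons p ps)
  have p: "shadow_at p w" and path: "braid_path (flip p w) ps" using Cons.prems(1) by auto
  then have len: "p + 2 < length w" "p + 2 < length v"
    using Cons.prems(2) by (auto simp: shadow_at_def)
  show ?case
  proof (cases "p \<in> A")
    case True
    then have A: "{p, p + 1, p + 2} \<subseteq> A" using Cons.prems(4)[of p] by auto
    then have eq: "v ! p = w ! p" "v ! (p + 1) = w ! (p + 1)" "v ! (p + 2) = w ! (p + 2)"
      using Cons.prems(3) by auto
    then have v: "shadow_at p v" using p len by (simp add: shadow_at_def)
    have "flip p v ! j = flip p w ! j" if "j \<in> A" for j
      using Cons.prems(3)[OF that] eq len by (simp add: nth_flip)
    then have "braid_path (flip p v) (filter (\<lambda>r. r \<in> A) ps)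
      \<and> (\<forall>j\<in>A. fold flip (filter (\<lambda>r. r \<in> A) ps) (flip p v) ! j = fold flip ps (flip p w) ! j)
      \<and> (\<forall>j. j \<notin> A \<longrightarrow> fold flip (filter (\<lambda>r. r \<in> A) ps) (flip p v) ! j = flip p v ! j)"
      by (intro Cons.IH[OF path]) (use Cons.prems in auto)
    moreover have "flip p v ! j = v ! j" if "j \<notin> A" for j
      using that A len by (auto simp: nth_flip)
    ultimately show ?thesis using True v by simp
  next
    case False
    then have A: "{p, p + 1, p + 2} \<inter> A = {}" using Cons.prems(4)[of p] by auto
    have "v ! j = flip p w ! j" if "j \<in> A" for j
      using Cons.prems(3)[OF that] that A len by (auto simp: nth_flip)
    then have "braid_path v (filter (\<lambda>r. r \<in> A) ps)
      \<and> (\<forall>j\<in>A. fold flip (filter (\<lambda>r. r \<in> A) ps) v ! j = fold flip ps (flip p w) ! j)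
      \<and> (\<forall>j. j \<notin> A \<longrightarrow> fold flip (filter (\<lambda>r. r \<in> A) ps) v ! j = v ! j)"
      by (intro Cons.IH[OF path]) (use Cons.prems in auto)
    then show ?thesis using False by simp
  qed
qed

text \<open>
  Moves that do not overlap \<open>p\<close> take place in the complement of \<open>{p, p + 1, p + 2}\<close>, so they can be
  performed without the two surrounding moves at \<open>p\<close>.
\<close>

lemma braid_path_cancel:
  assumes "braid_path w (p # bs @ [p])" and far: "\<And>r. r \<in> set bs \<Longrightarrow> r + 2 < p \<or> p + 2 < r"
  shows "braid_path w bs \<and> fold flip bs w = fold flip (p # bs @ [p]) w"
proof -
  let ?A = "- {p, p + 1, p + 2}" and ?u = "fold flip bs (flip p w)"
  have p: "shadow_at p w" "braid_path (flip p w) bs"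
    using assms(1) by (auto simp: braid_path_append)
  then have len: "p + 2 < length w" by (simp add: shadow_at_def)
  have bs: "filter (\<lambda>r. r \<in> ?A) bs = bs" using far by (fastforce simp: filter_id_conv)
  have res: "braid_path w bs \<and> (\<forall>j\<in>?A. fold flip bs w ! j = ?u ! j)
      \<and> (\<forall>j. j \<notin> ?A \<longrightarrow> fold flip bs w ! j = w ! j)"
    using braid_path_restrict[OF p(2), of w ?A, unfolded bs] far len
    by (force simp: nth_flip)
  have u: "?u ! j = flip p w ! j" if "j \<notin> ?A" for j
    by (rule fold_flip_untouched[OF p(2)]) (use far that in fastforce)
  have "fold flip bs w ! j = flip p ?u ! j" for j
  proof (cases "j \<in> ?A")
    case True
    then show ?thesis using res len by (auto simp: nth_flip)
  next
    case False
    then show ?thesis using res u len p(1) by (auto simp: nth_flip shadow_at_def)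
  qed
  then have "fold flip bs w = flip p ?u" by (intro nth_equalityI) auto
  then show ?thesis using res by simp
qed

text \<open>
  The earlier moves leave the center \<open>q + 1\<close> and the position \<open>j\<close> alone, so the move at \<open>q\<close> still sees
  the original letters there. An outer position of the shadow receives the letter of the center,
  and no later move overwrites \<open>j\<close>.
\<close>

lemma fold_flip_single_use:
  assumes "braid_path w ps" and "distinct ps" and "q \<in> set ps" and j: "j \<in> {q, q + 1, q + 2}"
    and only: "\<And>r. r \<in> set ps \<Longrightarrow> j \<in> {r, r + 1, r + 2} \<Longrightarrow> r = q"
    and center: "\<And>r. r \<in> set ps \<Longrightarrow> q + 1 \<in> {r, r + 1, r + 2} \<Longrightarrow> r = q"
  shows "bond (w ! j) (fold flip ps w ! j)"
    and "j \<noteq> q + 1 \<Longrightarrow> fold flip ps w ! j = w ! (q + 1)"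
proof -
  obtain as bs where ps: "ps = as @ q # bs" using assms(3) by (meson split_list)
  let ?v = "fold flip as w"
  have as: "braid_path w as" and q: "shadow_at q ?v" and bs: "braid_path (flip q ?v) bs"
    using assms(1) by (auto simp: ps braid_path_append)
  have nq: "r \<noteq> q" if "r \<in> set as \<union> set bs" for r using assms(2) that by (auto simp: ps)
  have 1: "?v ! j = w ! j"
    by (rule fold_flip_untouched[OF as]) (use only nq in \<open>auto simp: ps\<close>)
  have 2: "?v ! (q + 1) = w ! (q + 1)"
    by (rule fold_flip_untouched[OF as]) (use center nq in \<open>auto simp: ps\<close>)
  have 3: "fold flip ps w ! j = flip q ?v ! j"
    unfolding ps fold_append fold_simps o_apply
    by (rule fold_flip_untouched[OF bs]) (use only nq in \<open>auto simp: ps\<close>)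
  show "bond (w ! j) (fold flip ps w ! j)"
    using j q 1 by (auto simp: 3 nth_flip shadow_at_def bond_sym)
  show "fold flip ps w ! j = w ! (q + 1)" if "j \<noteq> q + 1"
    using j q 2 that by (auto simp: 3 nth_flip shadow_at_def)
qed


section \<open>Shadows in one braid class are not adjacent\<close>

text \<open>
  This is how reducedness enters: two equal neighbours cancel in the group, and all words of the
  class are reduced, so none of them has equal neighbours.
\<close>

definition square_free_class :: "'a list \<Rightarrow> bool" where
  "square_free_class w \<longleftrightarrow> (\<forall>ps j. braid_path w ps \<longrightarrow> Suc j < length w \<longrightarrow>
     fold flip ps w ! j \<noteq> fold flip ps w ! Suc j)"

lemma square_free_class_fold:
  "square_free_class w \<Longrightarrow> braid_path w ps \<Longrightarrow> square_free_class (fold flip ps w)"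
  unfolding square_free_class_def
  by (metis braid_path_append fold_append length_fold_flip o_apply)

lemma not_adjacent_in_word:
  assumes "square_free_class w" "shadow_at p w"
  shows "\<not> shadow_at (p + 1) w"
proof
  \<comment> \<open>The word contains \<open>stst\<close>, and the move at \<open>p\<close> turns this into \<open>tstt\<close>.\<close>
  assume "shadow_at (p + 1) w"
  then have "flip p w ! (p + 2) = flip p w ! Suc (p + 2)" "Suc (p + 2) < length w"
    using assms(2) by (auto simp: shadow_at_def nth_flip eval_nat_numeral)
  moreover have "braid_path w [p]" using assms(2) by simp
  ultimately show False using assms(1) unfolding square_free_class_def
    by (metis fold_simps)
qed

text \<open>
  By induction on the length of the connecting path, every shadow used on the way is adjacent
  neither to \<open>p\<close> nor to \<open>q\<close>. If \<open>p\<close> and \<open>q\<close> were adjacent, this would also exclude moves at \<open>p\<close> and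
  \<open>q\<close> themselves. Then no move could touch the two centers, hence none could touch both sides of the
  cut between them, and the moves on one side of it would lead to a word with both shadows.
\<close>

lemma shadows_not_adjacent:
  assumes "square_free_class w" "braid_path w ps" "shadow_at p w" "shadow_at q (fold flip ps w)"
  shows "p \<noteq> q + 1 \<and> q \<noteq> p + 1"
  using assms
proof (induction "length ps" arbitrary: w ps p q rule: less_induct)
  case less
  let ?z = "fold flip ps w"
  have between: "r \<noteq> p + 1 \<and> p \<noteq> r + 1 \<and> r \<noteq> q + 1 \<and> q \<noteq> r + 1" if r: "r \<in> set ps" for r
  proof -
    obtain as bs where ps: "ps = as @ r # bs" using r by (meson split_list)
    let ?v = "fold flip as w"
    have as: "braid_path w as" and v: "shadow_at r ?v" and bs: "braid_path (flip r ?v) bs"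
      using less.prems(2) by (auto simp: ps braid_path_append)
    have "square_free_class (flip r ?v)"
      using square_free_class_fold[OF less.prems(1), of "as @ [r]"] as v
      by (simp add: braid_path_append)
    then have "r \<noteq> q + 1 \<and> q \<noteq> r + 1"
      by (rule less.hyps[OF _ _ bs shadow_at_flip[OF v], rotated])
        (use less.prems(4) in \<open>simp_all add: ps\<close>)
    moreover have "p \<noteq> r + 1 \<and> r \<noteq> p + 1"
      by (rule less.hyps[OF _ less.prems(1) as less.prems(3) v]) (simp add: ps)
    ultimately show ?thesis by blast
  qed
  have contra: False
    if A: "\<And>r. r \<in> set ps \<Longrightarrow> {r, r + 1, r + 2} \<subseteq> A \<or> {r, r + 1, r + 2} \<inter> A = {}"
      and both: "\<And>v. length v = length w \<Longrightarrow> (\<And>j. j \<in> A \<Longrightarrow> v ! j = ?z ! j) \<Longrightarrow>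
        (\<And>j. j \<notin> A \<Longrightarrow> v ! j = w ! j) \<Longrightarrow> shadow_at l v \<and> shadow_at (l + 1) v" for A l
  proof -
    let ?v = "fold flip (filter (\<lambda>r. r \<in> A) ps) w"
    have v: "braid_path w (filter (\<lambda>r. r \<in> A) ps)" "\<forall>j\<in>A. ?v ! j = ?z ! j"
        "\<forall>j. j \<notin> A \<longrightarrow> ?v ! j = w ! j"
      using braid_path_restrict[OF less.prems(2), of w A] A by auto
    have "shadow_at l ?v \<and> shadow_at (l + 1) ?v" by (rule both) (use v in auto)
    then show False
      using not_adjacent_in_word square_free_class_fold[OF less.prems(1) v(1)] by blast
  qed
  have "q \<noteq> p + 1"
  proof
    assume q: "q = p + 1"
    have far: "r + 2 \<le> p \<or> p + 3 \<le> r" if "r \<in> set ps" for r using between[OF that] q by auto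
    have mid: "?z ! (p + 1) = w ! (p + 1)" "?z ! (p + 2) = w ! (p + 2)"
      by (rule fold_flip_untouched[OF less.prems(2)], use far in fastforce)+
    show False
    proof (rule contra[of "{p + 2..}" p])
      fix v :: "'a list"
      assume v: "length v = length w" "\<And>j. j \<in> {p + 2..} \<Longrightarrow> v ! j = ?z ! j"
        "\<And>j. j \<notin> {p + 2..} \<Longrightarrow> v ! j = w ! j"
      have "v ! p = w ! p" "v ! (p + 1) = w ! (p + 1)" "v ! (p + 2) = w ! (p + 2)"
        "v ! (p + 3) = ?z ! (p + 3)"
        using v(2)[of "p + 2"] v(2)[of "p + 3"] v(3)[of p] v(3)[of "p + 1"] mid by auto
      then show "shadow_at p v \<and> shadow_at (p + 1) v"
        using less.prems(3,4) v(1) mid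
        by (auto simp: shadow_at_def q bond_sym eval_nat_numeral)
    next
      fix r assume "r \<in> set ps"
      then show "{r, r + 1, r + 2} \<subseteq> {p + 2..} \<or> {r, r + 1, r + 2} \<inter> {p + 2..} = {}"
        using far[of r] by auto
    qed
  qed
  moreover have "p \<noteq> q + 1"
  proof
    assume p: "p = q + 1"
    have far: "r + 2 \<le> q \<or> q + 3 \<le> r" if "r \<in> set ps" for r using between[OF that] p by auto
    have mid: "?z ! (q + 1) = w ! (q + 1)" "?z ! (q + 2) = w ! (q + 2)"
      by (rule fold_flip_untouched[OF less.prems(2)], use far in fastforce)+
    show False
    proof (rule contra[of "{..q + 1}" q])
      fix v :: "'a list"
      assume v: "length v = length w" "\<And>j. j \<in> {..q + 1} \<Longrightarrow> v ! j = ?z ! j"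
        "\<And>j. j \<notin> {..q + 1} \<Longrightarrow> v ! j = w ! j"
      have "v ! q = ?z ! q" "v ! (q + 1) = w ! (q + 1)" "v ! (q + 2) = w ! (q + 2)"
        "v ! (q + 3) = w ! (q + 3)"
        using v(2)[of q] v(2)[of "q + 1"] v(3)[of "q + 2"] v(3)[of "q + 3"] mid by auto
      then show "shadow_at q v \<and> shadow_at (q + 1) v"
        using less.prems(3,4) v(1) mid
        by (auto simp: shadow_at_def p bond_sym eval_nat_numeral)
    next
      fix r assume "r \<in> set ps"
      then show "{r, r + 1, r + 2} \<subseteq> {..q + 1} \<or> {r, r + 1, r + 2} \<inter> {..q + 1} = {}"
        using far[of r] by auto
    qed
  qed
  ultimately show ?case by blast
qed

lemma used_shadows_not_adjacent:
  assumes "square_free_class w" "braid_path w ps" "shadow_at q (fold flip ps w)" "r \<in> set ps"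
  shows "r \<noteq> q + 1 \<and> q \<noteq> r + 1"
proof -
  obtain as bs where ps: "ps = as @ r # bs" using assms(4) by (meson split_list)
  let ?v = "fold flip as w"
  have as: "braid_path w as" and v: "shadow_at r ?v" and path: "braid_path ?v (r # bs)"
    using assms(2) by (auto simp: ps braid_path_append)
  show ?thesis
    by (rule shadows_not_adjacent[OF square_free_class_fold[OF assms(1) as] path v])
      (use assms(3) in \<open>simp add: ps\<close>)
qed

lemma path_shadows_not_adjacent:
  assumes "square_free_class w" "braid_path w ps" "q \<in> set ps" "r \<in> set ps"
  shows "r \<noteq> q + 1"
proof -
  have *: "r \<noteq> q + 1 \<and> q \<noteq> r + 1" if "ps = as @ q # bs" "r \<in> set as" for as bs q r
    by (rule used_shadows_not_adjacent[of w as])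
      (use assms(1,2) that in \<open>auto simp: braid_path_append\<close>)
  obtain as bs where ps: "ps = as @ q # bs" using assms(3) by (meson split_list)
  from assms(4) consider "r \<in> set as" | "r = q" | "r \<in> set bs" by (auto simp: ps)
  then show ?thesis
  proof cases
    case 3
    then obtain bs1 bs2 where "bs = bs1 @ r # bs2" by (meson split_list)
    then show ?thesis using *[of "as @ q # bs1" r bs2 q] ps by simp
  qed (use *[OF ps] in auto)
qed


section \<open>Shortest sequences of braid moves\<close>

text \<open>
  It suffices to consider two uses of \<open>p\<close> with distinct shadows, all different from \<open>p\<close>, between
  them. If one of these overlaps \<open>p\<close>, its move changes the letter \<open>a\<close> in the shared position to a
  letter bonded to \<open>a\<close>. The center of \<open>p\<close> keeps its letter, and this is bonded to the letter in the
  shared position both before and after, so there is a triangle. If none overlaps \<open>p\<close>, dropping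
  both uses of \<open>p\<close> gives a shorter path with the same ends.
\<close>

lemma shortest_braid_path_distinct:
  assumes free: "square_free_class w" and path: "braid_path w ps"
    and shortest: "\<And>qs. braid_path w qs \<Longrightarrow> fold flip qs w = fold flip ps w \<Longrightarrow>
      length ps \<le> length qs"
    and triangle_free: "\<And>a b x. bond a b \<Longrightarrow> bond b x \<Longrightarrow> bond x a \<Longrightarrow> False"
  shows "distinct ps"
proof (rule ccontr)
  assume "\<not> distinct ps"
  then obtain xs p cs where xs: "p \<in> set xs" "distinct xs" "ps = xs @ p # cs"
    by (auto simp: not_distinct_conv_prefix)
  then obtain as bs where "xs = as @ p # bs" by (meson split_list)
  with xs have bs: "distinct bs" "p \<notin> set bs" and ps: "ps = as @ (p # bs @ [p]) @ cs" by auto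
  define u where "u = fold flip as w"
  define v where "v = flip p u"
  define z where "z = fold flip bs v"
  have paths: "braid_path w as" "braid_path u (p # bs @ [p])" "braid_path v bs"
    and shadows: "shadow_at p v" "shadow_at p z"
    using path shadow_at_flip by (auto simp: ps braid_path_append u_def v_def z_def)
  have near: "r = p + 2 \<or> p = r + 2 \<or> r + 2 < p \<or> p + 2 < r" if "r \<in> set bs" for r
  proof -
    have "r \<noteq> p" "r \<in> set ps" "p \<in> set ps" using that bs(2) by (auto simp: ps)
    then show ?thesis
      using path_shadows_not_adjacent[OF free path, of p r]
        path_shadows_not_adjacent[OF free path, of r p] by linarith
  qed
  have mid: "z ! (p + 1) = v ! (p + 1)"
    unfolding z_def by (rule fold_flip_untouched[OF paths(3)]) (use near in fastforce)
  show False
  proof (cases "\<exists>r\<in>set bs. r = p + 2 \<or> p = r + 2")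
    case True
    then obtain r where r: "r \<in> set bs" "r = p + 2 \<or> p = r + 2" by blast
    \<comment> \<open>The position that the shadows at \<open>p\<close> and \<open>r\<close> share.\<close>
    define j where "j = (if r = p + 2 then p + 2 else p)"
    have "bond (v ! j) (z ! j)"
      unfolding z_def
    proof (rule fold_flip_single_use[OF paths(3) bs(1) r(1)])
      show "j \<in> {r, r + 1, r + 2}" using r(2) by (auto simp: j_def)
    next
      fix r' assume r': "r' \<in> set bs" "j \<in> {r', r' + 1, r' + 2}"
      then show "r' = r" using r(2) near[OF r'(1)] by (auto simp: j_def split: if_splits)
    next
      fix r' assume r': "r' \<in> set bs" "r + 1 \<in> {r', r' + 1, r' + 2}"
      then show "r' = r"
        using path_shadows_not_adjacent[OF free path, of r r']
          path_shadows_not_adjacent[OF free path, of r' r] r(1) by (auto simp: ps)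
    qed
    moreover have "bond (v ! j) (v ! (p + 1))" "bond (z ! j) (v ! (p + 1))"
      using shadows mid by (auto simp: j_def shadow_at_def)
    ultimately show False using triangle_free bond_sym by blast
  next
    case False
    have cancel: "braid_path u bs \<and> fold flip bs u = fold flip (p # bs @ [p]) u"
      by (rule braid_path_cancel[OF paths(2)]) (use near False in blast)
    have "length ps \<le> length (as @ bs @ cs)"
    proof (rule shortest)
      show "braid_path w (as @ bs @ cs)"
        using path cancel by (simp add: ps braid_path_append u_def)
      show "fold flip (as @ bs @ cs) w = fold flip ps w"
        using cancel by (simp add: ps u_def)
    qed
    then show False by (simp add: ps)
  qed
qed

text \<open>
  A center is covered by no shadow of the class but its own, because any other one covering it
  would be adjacent to its own. So the moves that change a letter at a center are exactly those at
  this center, and each of them occurs once.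
\<close>

lemma distinct_path_changed_centers:
  assumes free: "square_free_class w" and path: "braid_path w ps" and "distinct ps"
    and centers: "\<And>p. p + 1 \<in> X \<longleftrightarrow> (\<exists>qs. braid_path w qs \<and> shadow_at p (fold flip qs w))"
    and "0 \<notin> X"
  shows "card {i \<in> X. w ! i \<noteq> fold flip ps w ! i} = length ps"
proof -
  have "{i \<in> X. w ! i \<noteq> fold flip ps w ! i} = Suc ` set ps"
  proof (intro equalityI subsetI)
    fix i assume "i \<in> Suc ` set ps"
    then obtain q where q: "q \<in> set ps" "i = q + 1" by auto
    then obtain as bs where ps: "ps = as @ q # bs" by (meson split_list)
    then have "i \<in> X" using path q(2) centers[of q] by (auto simp: braid_path_append)
    have only: "r = q" if "r \<in> set ps" "q + 1 \<in> {r, r + 1, r + 2}" for r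
      using path_shadows_not_adjacent[OF free path, of q r]
        path_shadows_not_adjacent[OF free path, of r q] q(1) that by auto
    have "bond (w ! i) (fold flip ps w ! i)"
      unfolding q(2)
      by (rule fold_flip_single_use[OF path \<open>distinct ps\<close> q(1)]) (use only in auto)
    then show "i \<in> {i \<in> X. w ! i \<noteq> fold flip ps w ! i}" using \<open>i \<in> X\<close> bond_irrefl by auto
  next
    fix i assume i: "i \<in> {i \<in> X. w ! i \<noteq> fold flip ps w ! i}"
    then obtain p where p: "i = p + 1" using \<open>0 \<notin> X\<close> by (cases i) auto
    then obtain qs where qs: "braid_path w qs" "shadow_at p (fold flip qs w)"
      using i centers by auto
    have "fold flip ps w ! i \<noteq> w ! i" using i by auto
    then obtain r where r: "r \<in> set ps" "i \<in> {r, r + 1, r + 2}"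
      using fold_flip_untouched[OF path, of i] by blast
    obtain as bs where ps: "ps = as @ r # bs" using r(1) by (meson split_list)
    let ?v = "fold flip as w"
    have as: "braid_path w as" and v: "shadow_at r ?v" using path by (auto simp: ps braid_path_append)
    obtain rs where rs: "braid_path ?v rs" "fold flip rs ?v = fold flip qs w"
      using as qs(1) by (metis braid_path_connect)
    have "r \<noteq> p + 1 \<and> p \<noteq> r + 1"
      by (rule shadows_not_adjacent[OF square_free_class_fold[OF free as] rs(1) v])
        (use rs qs in simp)
    then show "i \<in> Suc ` set ps" using r p by auto
  qed
  then show ?thesis using \<open>distinct ps\<close> by (simp add: card_image distinct_card)
qed

end


section \<open>Braid classes of reduced expressions\<close>

definition coxeter_bond :: "'a set \<Rightarrow> ('a \<Rightarrow> 'a \<Rightarrow> enat) \<Rightarrow> 'a \<Rightarrow> 'a \<Rightarrow> bool" where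
  "coxeter_bond S m s t \<longleftrightarrow> s \<in> S \<and> t \<in> S \<and> m s t = 3"

text \<open>Deleting two equal neighbours would give a shorter word with the same value.\<close>

lemma reduced_expression_no_square:
  assumes C: "coxeter_system S m" and red: "reduced_expression S m w"
    and j: "Suc j < length w"
  shows "w ! j \<noteq> w ! Suc j"
proof
  assume eq: "w ! j = w ! Suc j"
  let ?W = "word_value S m" and ?G = "coxeter_group S m"
  let ?u = "take j w" and ?v = "drop (j + 2) w" and ?a = "w ! j"
  interpret G: group ?G unfolding coxeter_group_def by (rule group_presented_group)
  have w: "w \<in> lists S" and least: "\<And>x. x \<in> lists S \<Longrightarrow> ?W x = ?W w \<Longrightarrow> length w \<le> length x"
    using red unfolding reduced_expression_def reduced_expression_for_def is_arg_min_def
    by (auto simp: not_less)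
  have split: "w = ?u @ [?a, ?a] @ ?v"
  proof -
    have "drop j w = w ! j # w ! Suc j # drop (j + 2) w"
      using j by (simp add: Cons_nth_drop_Suc)
    then show ?thesis using eq by (metis append_Cons append_Nil append_take_drop_id)
  qed
  have uv: "?u \<in> lists S" "?v \<in> lists S" and a: "?a \<in> S"
    using w j by (auto simp: in_lists_conv_set dest: in_set_takeD in_set_dropD)
  have clo: "?W x \<in> carrier ?G" if "x \<in> lists S" for x
    unfolding word_value_eq_class[OF that] coxeter_group_def
    by (rule presented_group_carrierI) (use that in auto)
  have sq: "?W [?a, ?a] = \<one>\<^bsub>?G\<^esub>"
    using word_value_relator[of ?a S ?a m 1] a C by (simp add: coxeter_system_def one_enat_def)
  have aa: "[?a, ?a] \<in> lists S" "[?a, ?a] @ ?v \<in> lists S" using a uv by auto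
  have "?W w = ?W (?u @ [?a, ?a] @ ?v)" using split by simp
  also have "\<dots> = ?W ?u \<otimes>\<^bsub>?G\<^esub> (?W [?a, ?a] \<otimes>\<^bsub>?G\<^esub> ?W ?v)"
    by (simp only: word_value_append[OF uv(1) aa(2)] word_value_append[OF aa(1) uv(2)])
  also have "\<dots> = ?W (?u @ ?v)"
    by (simp only: sq G.l_one[OF clo[OF uv(2)]] word_value_append[OF uv])
  finally have "length w \<le> length (?u @ ?v)" using uv by (intro least) auto
  then show False using j by simp
qed

lemma card_nth_positions:
  "distinct xs \<Longrightarrow> card {k. k < length xs \<and> P (xs ! k)} = card {x \<in> set xs. P x}"
  by (metis distinct_card distinct_filter length_filter_conv_card set_filter)

lemma Delta_map_nth:
  assumes "finite X"
  shows "Delta (map (\<lambda>i. \<alpha> ! i) (sorted_list_of_set X)) (map (\<lambda>i. \<beta> ! i) (sorted_list_of_set X))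
    = card {i \<in> X. \<alpha> ! i \<noteq> \<beta> ! i}"
proof -
  let ?xs = "sorted_list_of_set X"
  have "{k. k < length (map ((!) \<alpha>) ?xs) \<and> map ((!) \<alpha>) ?xs ! k \<noteq> map ((!) \<beta>) ?xs ! k}
      = {k. k < length ?xs \<and> \<alpha> ! (?xs ! k) \<noteq> \<beta> ! (?xs ! k)}"
    by auto
  then show ?thesis
    using card_nth_positions[of ?xs "\<lambda>i. \<alpha> ! i \<noteq> \<beta> ! i"] assms by (simp add: Delta_def)
qed

locale coxeter_words =
  fixes S :: "'a set" and m :: "'a \<Rightarrow> 'a \<Rightarrow> enat"
  assumes coxeter: "coxeter_system S m"
begin

sublocale bond_relation "coxeter_bond S m"
proof
  fix s t assume "coxeter_bond S m s t"
  then show "coxeter_bond S m t s" using coxeter by (auto simp: coxeter_bond_def coxeter_system_def)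
next
  fix s show "\<not> coxeter_bond S m s s"
    using coxeter by (auto simp: coxeter_bond_def coxeter_system_def one_enat_def numeral_eq_enat)
qed

lemma braid_move_iff: "braid_move S m w v \<longleftrightarrow> (\<exists>p. shadow_at p w \<and> v = flip p w)"
proof
  assume "braid_move S m w v"
  then obtain x y s t where st: "coxeter_bond S m s t"
    and w: "w = x @ [s, t, s] @ y" and v: "v = x @ [t, s, t] @ y"
    unfolding braid_move_def coxeter_bond_def by blast
  have "shadow_at (length x) w" using st by (simp add: shadow_at_def w nth_append)
  moreover have "v = flip (length x) w"
    by (simp add: flip_def w v nth_append list_update_append)
  ultimately show "\<exists>p. shadow_at p w \<and> v = flip p w" by blast
next
  assume "\<exists>p. shadow_at p w \<and> v = flip p w"
  then obtain p where p: "shadow_at p w" and v: "v = flip p w" by blast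
  let ?s = "w ! p" and ?t = "w ! (p + 1)"
  have len: "p + 2 < length w" using p by (simp add: shadow_at_def)
  have "w = take p w @ [?s, ?t, w ! (p + 2)] @ drop (p + 3) w"
    using len by (simp add: Cons_nth_drop_Suc eval_nat_numeral)
  then have w: "w = take p w @ [?s, ?t, ?s] @ drop (p + 3) w" using p by (simp add: shadow_at_def)
  have "flip p w = flip p (take p w @ [?s, ?t, ?s] @ drop (p + 3) w)" using w by simp
  also have "\<dots> = take p w @ [?t, ?s, ?t] @ drop (p + 3) w"
    using len by (simp add: flip_def nth_append list_update_append)
  finally show "braid_move S m w v"
    using p w unfolding braid_move_def v shadow_at_def coxeter_bond_def by blast
qed

lemma braid_equiv_iff:
  "braid_equiv S m w v \<longleftrightarrow> (\<exists>ps. braid_path w ps \<and> fold flip ps w = v)"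
proof
  assume "braid_equiv S m w v"
  then have "(braid_move S m)\<^sup>*\<^sup>* w v" by (simp add: braid_equiv_def)
  then show "\<exists>ps. braid_path w ps \<and> fold flip ps w = v"
  proof (induction rule: rtranclp_induct)
    case base
    show ?case by (intro exI[of _ "[]"]) simp
  next
    case (step v z)
    then obtain ps p where "braid_path w ps" "fold flip ps w = v" "shadow_at p v" "z = flip p v"
      by (auto simp: braid_move_iff)
    then show ?case by (intro exI[of _ "ps @ [p]"]) (simp add: braid_path_append)
  qed
next
  assume "\<exists>ps. braid_path w ps \<and> fold flip ps w = v"
  then obtain ps where "braid_path w ps" "fold flip ps w = v" by blast
  then have "(braid_move S m)\<^sup>*\<^sup>* w v"
  proof (induction ps arbitrary: w)
    case (Cons p ps)
    then have "braid_move S m w (flip p w)" by (auto simp: braid_move_iff)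
    moreover have "(braid_move S m)\<^sup>*\<^sup>* (flip p w) v" using Cons by simp
    ultimately show ?case by (rule converse_rtranclp_into_rtranclp)
  qed simp
  then show "braid_equiv S m w v" by (simp add: braid_equiv_def)
qed

lemma reduced_square_free_class:
  assumes "reduced_expression S m w"
  shows "square_free_class w"
  unfolding square_free_class_def
proof (intro allI impI)
  fix ps j assume "braid_path w ps" "Suc j < length w"
  moreover from this(1) have "reduced_expression S m (fold flip ps w)"
    using reduced_expression_braid_equiv[OF coxeter assms] braid_equiv_iff by blast
  ultimately show "fold flip ps w ! j \<noteq> fold flip ps w ! Suc j"
    using reduced_expression_no_square[OF coxeter] by simp
qed

lemma Suc_shadow_center_iff:
  "p + 1 \<in> shadow_centers S m w \<longleftrightarrow> (\<exists>ps. braid_path w ps \<and> shadow_at p (fold flip ps w))"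
proof -
  have eq: "{p, p + 1, p + 2} = {i - 1, i, i + 1} \<longleftrightarrow> i = p + 1" if "1 \<le> i" for i
  proof
    assume *: "{p, p + 1, p + 2} = {i - 1, i, i + 1}"
    then have "p \<in> {i - 1, i, i + 1}" "p + 2 \<in> {i - 1, i, i + 1}" by blast+
    then show "i = p + 1" using that by auto
  qed auto
  have "{p, p + 1, p + 2} \<in> braid_shadows S m v \<longleftrightarrow> shadow_at p v" for v
  proof
    assume "{p, p + 1, p + 2} \<in> braid_shadows S m v"
    then obtain i where i: "{p, p + 1, p + 2} = {i - 1, i, i + 1}" "1 \<le> i" "i + 1 < length v"
      "\<exists>s\<in>S. \<exists>t\<in>S. m s t = 3 \<and> v ! (i - 1) = s \<and> v ! i = t \<and> v ! (i + 1) = s"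
      unfolding braid_shadows_def by blast
    then have "i = p + 1" using eq by blast
    then show "shadow_at p v" using i(3,4) by (auto simp: shadow_at_def coxeter_bond_def)
  next
    assume "shadow_at p v"
    then show "{p, p + 1, p + 2} \<in> braid_shadows S m v"
      unfolding braid_shadows_def
      by (intro CollectI exI[of _ "p + 1"]) (auto simp: shadow_at_def coxeter_bond_def)
  qed
  then show ?thesis
    by (auto simp: shadow_centers_def class_shadows_def braid_class_def braid_equiv_iff)
qed

lemma braid_class_cong:
  assumes "braid_equiv S m w v"
  shows "braid_class S m v = braid_class S m w"
proof -
  obtain ps where ps: "braid_path w ps" "fold flip ps w = v"
    using assms braid_equiv_iff by blast
  then have "braid_equiv S m v w" using braid_path_rev braid_equiv_iff by blast
  then show ?thesis using assms by (auto simp: braid_class_def braid_equiv_def)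
qed

text \<open>
  The shadows that a walk uses determine it, so walks in the braid graph and lists of shadows
  correspond, with equal lengths.
\<close>

lemma awalk_braid_graph_iff:
  assumes "u \<in> braid_class S m w"
  shows "(\<exists>es. length es = n \<and> pre_digraph.awalk (with_proj (braid_graph S m w)) u es v)
    \<longleftrightarrow> (\<exists>ps. length ps = n \<and> braid_path u ps \<and> fold flip ps u = v)"
  using assms
proof (induction n arbitrary: u)
  interpret pair_wf_digraph "braid_graph S m w" by (rule pair_wf_digraph_braid_graph)
  case 0
  then show ?case by (simp add: awalk_Nil_iff) (auto simp: braid_graph_def)
next
  interpret pair_wf_digraph "braid_graph S m w" by (rule pair_wf_digraph_braid_graph)
  case (Suc n)
  have closed: "flip p u \<in> braid_class S m w" if "shadow_at p u" for p
  proof -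
    have "braid_move S m u (flip p u)" using that braid_move_iff by blast
    then show ?thesis
      using Suc.prems by (auto simp: braid_class_def braid_equiv_def)
  qed
  have "(\<exists>es. length es = Suc n \<and> awalk u es v)
      \<longleftrightarrow> (\<exists>u'. (u, u') \<in> parcs (braid_graph S m w) \<and> (\<exists>es. length es = n \<and> awalk u' es v))"
    by (simp only: length_Suc_conv) (force simp: awalk_Cons_iff)
  also have "\<dots> \<longleftrightarrow> (\<exists>p. shadow_at p u \<and> (\<exists>es. length es = n \<and> awalk (flip p u) es v))"
    using Suc.prems closed by (auto simp: braid_graph_def braid_move_iff)
  also have "\<dots> \<longleftrightarrow> (\<exists>p. shadow_at p u \<and>
      (\<exists>ps. length ps = n \<and> braid_path (flip p u) ps \<and> fold flip ps (flip p u) = v))"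
    using Suc.IH closed by blast
  also have "\<dots> \<longleftrightarrow> (\<exists>ps. length ps = Suc n \<and> braid_path u ps \<and> fold flip ps u = v)"
    by (simp only: length_Suc_conv) force
  finally show ?case .
qed

lemma graph_dist_shortest_braid_path:
  assumes path: "braid_path w ps" "fold flip ps w = v"
    and shortest: "\<And>qs. braid_path w qs \<Longrightarrow> fold flip qs w = v \<Longrightarrow> length ps \<le> length qs"
  shows "graph_dist (braid_graph S m w) w v = ereal (real (length ps))"
proof -
  let ?walk = "\<lambda>es. pre_digraph.awalk (with_proj (braid_graph S m w)) w es v"
  have w: "w \<in> braid_class S m w" by (simp add: braid_class_def braid_equiv_def)
  obtain es where es: "length es = length ps" "?walk es"
    using awalk_braid_graph_iff[OF w, of "length ps" v] path by blast
  have "length ps \<le> length es'" if "?walk es'" for es'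
    using awalk_braid_graph_iff[OF w, of "length es'" v] that shortest by fastforce
  then have "(INF es\<in>{es. ?walk es}. ereal (real (length es))) = ereal (real (length ps))"
    by (intro antisym INF_lower2[of es] INF_greatest) (use es in auto)
  then show ?thesis by (simp add: graph_dist_conv[OF pair_wf_digraph_braid_graph])
qed

end

lemma type_Lambda_no_bond_triangle:
  assumes "coxeter_system S m" "type_Lambda S m"
    and "coxeter_bond S m a b" "coxeter_bond S m b x" "coxeter_bond S m x a"
  shows False
proof -
  interpret coxeter_words S m by unfold_locales (rule assms(1))
  have edge: "{s, t} \<in> coxeter_edges S m" if "coxeter_bond S m s t" for s t
    using that unfolding coxeter_edges_def coxeter_bond_def by force
  have "a \<noteq> b" "b \<noteq> x" "x \<noteq> a" using assms(3-5) bond_irrefl by auto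
  then show False
    using assms(2) edge[OF assms(3)] edge[OF assms(4)] edge[OF assms(5)] assms(3-5)
    unfolding type_Lambda_def coxeter_bond_def by blast
qed

theorem corollary5p4:
  fixes S :: "'a set" and m :: "'a \<Rightarrow> 'a \<Rightarrow> enat" and \<alpha> \<beta> :: "'a list"
  assumes "coxeter_system S m" and "type_Lambda S m"
    and "reduced_expression S m \<alpha>" and "reduced_expression S m \<beta>"
    and "braid_equiv S m \<alpha> \<beta>"
  shows "graph_dist (braid_graph S m \<alpha>) \<alpha> \<beta> =
    ereal (real (Delta (signature S m \<alpha>) (signature S m \<beta>)))"
proof -
  interpret coxeter_words S m by unfold_locales (rule assms(1))
  let ?path = "\<lambda>ps. braid_path \<alpha> ps \<and> fold flip ps \<alpha> = \<beta>"
  have "\<exists>ps. ?path ps" using assms(5) braid_equiv_iff by blast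
  then obtain ps where path: "?path ps" and shortest: "\<And>qs. ?path qs \<Longrightarrow> length ps \<le> length qs"
    using ex_has_least_nat[of ?path _ length] by blast
  note free = reduced_square_free_class[OF assms(3)]
  have "distinct ps"
    by (rule shortest_braid_path_distinct[OF free])
      (use path shortest type_Lambda_no_bond_triangle[OF assms(1,2)] in blast)+
  let ?X = "shadow_centers S m \<alpha>"
  have "0 \<notin> ?X" by (simp add: shadow_centers_def)
  then have changed: "card {i \<in> ?X. \<alpha> ! i \<noteq> \<beta> ! i} = length ps"
    using distinct_path_changed_centers[OF free _ \<open>distinct ps\<close> Suc_shadow_center_iff] path by blast
  have "shadow_centers S m \<beta> = ?X"
    using braid_class_cong[OF assms(5)] by (simp add: shadow_centers_def class_shadows_def)
  then have "Delta (signature S m \<alpha>) (signature S m \<beta>) = length ps"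
    by (simp add: signature_def Delta_map_nth finite_shadow_centers changed)
  then show ?thesis using graph_dist_shortest_braid_path path shortest by metis
qed

end
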